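(* Let $n\ge 2$. The set $$\{\boldsymbol{u}^i\boldsymbol{u}^j : 1\le i,j\le n-1,\ i\neq j\}\ \cup\ \{\overline{\boldsymbol{x}}^i\}_{i=1}^{k-1}\ \cup\ \{\overline{\boldsymbol{y}}^i\}_{i=1}^{k'-1}$$ is an orthogonal basis of $\overline{V}_n$.
   Context: $\overline{V}_n$ is the space of real $n\times n$ matrices $(x_{ab})_{1\le a,b\le n}$ all of whose row sums and column sums are zero and which satisfy $\sum_{a} x_{a,a}=0=\sum_a x_{a,n-a+1}$; matrices carry the entrywise (Frobenius) dot product. For $\boldsymbol{a},\boldsymbol{b}\in\mathbb{R}^n$, $\boldsymbol{a}\boldsymbol{b}$ denotes the outer product (the $n\times n$ matrix with $(p,q)$ entry $a_pb_q$). Definition of $\boldsymbol{w}(r)$ for integers $r\geq 2$: $\boldsymbol{w}(r)=(w(r)_0,\dots,w(r)_{r-1})$, where: if $r$ is odd, $w(r)_i=(r-1)/2$ for $i$ even and $-(r+1)/2$ for $i$ odd; $\boldsymbol{w}(2)=(1,-1)$; $\boldsymbol{w}(4)=(1,-1,-1,1)$; if $r=2m$ is even with $r>4$, $w(r)_i=w(m)_{i\bmod m}$. Definition of $U(N)$ for $N\ge2$: build a rooted, vector-labeled binary tree $T_N$ whose root is labeled $\boldsymbol{w}(N)\in\mathbb{R}^N$. For a vertex with label $\boldsymbol{u}$, let $i_0<\dots<i_{a'-1}$ be the indices with $u_i>0$ and $j_0<\dots<j_{a''-1}$ those with $u_j<0$. If $a'\ge2$, add a left child labeled $\boldsymbol{u}'$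 with $u'_{i_r}=w(a')_r$ and $0$ elsewhere; if $a''\ge2$, add a right child labeled $\boldsymbol{u}''$ with $u''_{j_r}=w(a'')_r$ and $0$ elsewhere; if $a'=a''=1$ the vertex is a leaf. $U(N)=\{\boldsymbol{u}^{N;1},\dots,\boldsymbol{u}^{N;N-1}\}$, where $\boldsymbol{u}^{N;i}$ is the label of the $i$-th vertex in a depth-first (preorder) traversal of $T_N$, left child before right child. Write $\boldsymbol{u}^i=\boldsymbol{u}^{n;i}$. An element of $U(N)$ is skew-symmetric if its nonzero entries, read in order, are $(1,-1)$, and symmetric otherwise. For $\boldsymbol{v}\in U(N)$ write $v_j$ ($1\le j\le N-1$... ) — here, for a vector $\boldsymbol{v}=(v_0,\dots,v_{N-1})$ and $1\le j\le N$, write $v_{(j)}$ for its $j$-th entry $v_{j-1}$. Let $k=\lfloor n/2\rfloor$ and $k'=\lfloor (n-1)/2\rfloor$ (the numbers of skew-symmetric and symmetric elements of $U(n)$). Let $\boldsymbol{x}^1,\dots,\boldsymbol{x}^k$ be the matrices $\boldsymbol{u}^i\boldsymbol{u}^i$ with $\boldsymbol{u}^i$ skew-symmetric, and $\boldsymbol{y}^1,\dots,\boldsymbol{y}^{k'}$ the matrices $\boldsymbol{u}^i\boldsymbol{u}^i$ with $\boldsymbol{u}^i$ symmetric (each listed in increasing order of $i$). For $1\le i\le k-1$ set $\overline{\boldsymbol{x}}^i=\sum_{j=1}^{k}u^{k;i}_{(j)}\,\boldsymbol{x}^j$. Let $\ell_i=\sum_{a=1}^n(\boldsymbol{y}^i)_{aa}$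 (the trace of $\boldsymbol{y}^i$) for $1\le i\le k'$ and $\ell=\operatorname{lcm}\{\ell_1,\dots,\ell_{k'}\}$; for $1\le i\le k'-1$ set $\overline{\boldsymbol{y}}^i=\sum_{j=1}^{k'}\frac{\ell}{\ell_j}u^{k';i}_{(j)}\,\boldsymbol{y}^j$. (When $k\le 1$, respectively $k'\le 1$, the corresponding family is empty.) *)

theory Defs
  imports "HOL-Analysis.Analysis" "HOL-Library.Tree"
begin

text \<open>All the vectors \<open>w(r)\<close> and all tree labels have integer entries; they are represented as
  integer lists, so that the least common multiple below makes sense, and are embedded into the reals
  when matrices are formed. Only \<open>r \<ge> 2\<close> is meaningful.\<close>

fun wvec :: "nat \<Rightarrow> int list" where
  "wvec r =
    (if odd r then
       map (\<lambda>i. if even i then (int r - 1) div 2 else - ((int r + 1) div 2)) [0..<r]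
     else if r = 0 then []
     else if r = 2 then [1, -1]
     else if r = 4 then [1, -1, -1, 1]
     else map (\<lambda>i. wvec (r div 2) ! (i mod (r div 2))) [0..<r])"

declare wvec.simps [simp del]

definition pos_idx :: "int list \<Rightarrow> nat list" where
  "pos_idx u = filter (\<lambda>i. u ! i > 0) [0..<length u]"

definition neg_idx :: "int list \<Rightarrow> nat list" where
  "neg_idx u = filter (\<lambda>i. u ! i < 0) [0..<length u]"

text \<open>The vector of length \<open>N\<close> with entry \<open>v\<^sub>r\<close> at the \<open>r\<close>-th index listed in \<open>is\<close>,
  and entry \<open>0\<close> at the indices not listed.\<close>

definition place :: "nat \<Rightarrow> nat list \<Rightarrow> int list \<Rightarrow> int list" where
  "place N is v = map (\<lambda>i. case map_of (zip is v) i of None \<Rightarrow> 0 | Some x \<Rightarrow> x) [0..<N]"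

lemma length_wvec [simp]: "length (wvec r) = r"
  by (subst wvec.simps) auto

lemma wvec_mixed:
  "r \<ge> 2 \<Longrightarrow> (\<exists>i<r. wvec r ! i > 0) \<and> (\<exists>i<r. wvec r ! i < 0)"
proof (induction r rule: less_induct)
  case (less r)
  show ?case
  proof (cases "odd r")
    case True
    then have "r \<ge> 3" using less.prems by presburger
    with True have "wvec r ! 0 > 0" "wvec r ! 1 < 0"
      by (auto simp: wvec.simps[of r] wvec.simps[of 2] wvec.simps[of 4])
    then show ?thesis using less.prems
      by (metis One_nat_def Suc_1 Suc_le_lessD less_le_trans zero_less_numeral)
  next
    case False
    consider "r = 2" | "r = 4" | "r \<noteq> 2" "r \<noteq> 4" by blast
    then show ?thesis
    proof cases
      case 1
      then have "wvec r ! 0 > 0" "wvec r ! 1 < 0" by (auto simp: wvec.simps[of r] wvec.simps[of 2] wvec.simps[of 4])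
      then show ?thesis using less.prems by (intro conjI exI[of _ 0] exI[of _ 1]) auto
    next
      case 2
      then have "wvec r ! 0 > 0" "wvec r ! 1 < 0" by (auto simp: wvec.simps[of r] wvec.simps[of 2] wvec.simps[of 4])
      then show ?thesis using less.prems by (intro conjI exI[of _ 0] exI[of _ 1]) auto
    next
      case 3
      define m where "m = r div 2"
      have m: "m \<ge> 2" "m < r" using 3 False less.prems unfolding m_def by presburger+
      obtain i j where ij: "i < m" "wvec m ! i > 0" "j < m" "wvec m ! j < 0"
        using less.IH[OF m(2,1)] by blast
      have eq: "wvec r ! t = wvec m ! t" if "t < m" for t
        using that 3 False less.prems m by (auto simp: wvec.simps[of r] simp flip: m_def)
      show ?thesis using ij eq m by (metis less_trans)
    qed
  qed
qed

definition mixed :: "int list \<Rightarrow> bool" where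
  "mixed u \<longleftrightarrow> (\<exists>i<length u. u ! i > 0) \<and> (\<exists>i<length u. u ! i < 0)"

definition label_measure :: "int list \<Rightarrow> nat" where
  "label_measure u = 2 * card {i. i < length u \<and> u ! i \<noteq> 0} + (if mixed u then 0 else 1)"

lemma label_measure_place:
  assumes "distinct is" "set is \<subseteq> {..<N}" "length is \<ge> 2"
  shows "label_measure (place N is (wvec (length is))) \<le> 2 * length is"
proof -
  let ?v = "wvec (length is)"
  let ?p = "place N is ?v"
  have len: "length ?p = N" by (simp add: place_def)
  have at: "?p ! (is ! r) = ?v ! r" if "r < length is" for r
  proof -
    have "map_of (zip is ?v) (is ! r) = Some (?v ! r)"
      using that assms(1) by (intro map_of_zip_nth) auto
    moreover have "is ! r < N" using that assms(2) nth_mem by blast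
    ultimately show ?thesis by (simp add: place_def)
  qed
  have mem: "is ! r < N" if "r < length is" for r using that assms(2) nth_mem by blast
  have "mixed ?p"
    unfolding mixed_def len using wvec_mixed[OF assms(3)] at mem by metis
  moreover have "{i. i < length ?p \<and> ?p ! i \<noteq> 0} \<subseteq> set is"
  proof
    fix i assume "i \<in> {i. i < length ?p \<and> ?p ! i \<noteq> 0}"
    then have "i < N" "?p ! i \<noteq> 0" by (auto simp: len)
    then obtain x where "map_of (zip is ?v) i = Some x"
      by (cases "map_of (zip is ?v) i") (auto simp: place_def)
    then show "i \<in> set is" by (meson map_of_SomeD set_zip_leftD)
  qed
  then have "card {i. i < length ?p \<and> ?p ! i \<noteq> 0} \<le> length is"
    using card_mono[OF finite_set, of _ "is"] card_length[of "is"] by (meson le_trans)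
  ultimately show ?thesis by (simp add: label_measure_def)
qed

lemma label_measure_bound:
  assumes "s = 1 \<or> s = (-1::int)" and "is = filter (\<lambda>i. s * u ! i > 0) [0..<length u]"
  shows "label_measure u > 2 * length is"
proof -
  let ?Z = "{i. i < length u \<and> u ! i \<noteq> 0}"
  have len: "length is = card (set is)" unfolding assms(2) by (rule distinct_card[symmetric]) simp
  have sub: "set is \<subseteq> ?Z" by (auto simp: assms(2))
  show ?thesis
  proof (cases "mixed u")
    case True
    then obtain i where "i < length u" "s * u ! i < 0"
      using assms(1) unfolding mixed_def by auto
    then have "i \<in> ?Z" "i \<notin> set is" by (auto simp: assms(2))
    with sub have "set is \<subset> ?Z" by blast
    then have "card (set is) < card ?Z" by (intro psubset_card_mono) auto
    with True len show ?thesis by (simp add: label_measure_def)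
  next
    case False
    have "card (set is) \<le> card ?Z" using sub by (intro card_mono) auto
    with False len show ?thesis by (simp add: label_measure_def)
  qed
qed

text \<open>The tree below a vertex labelled \<open>u\<close>; a missing child is a \<^const>\<open>Leaf\<close>, so the leaves of
  \<open>T\<^sub>N\<close> are the nodes both of whose subtrees are \<^const>\<open>Leaf\<close>.\<close>

function label_tree :: "int list \<Rightarrow> int list tree" where
  "label_tree u =
     Node
       (if length (pos_idx u) \<ge> 2
        then label_tree (place (length u) (pos_idx u) (wvec (length (pos_idx u)))) else Leaf)
       u
       (if length (neg_idx u) \<ge> 2
        then label_tree (place (length u) (neg_idx u) (wvec (length (neg_idx u)))) else Leaf)"
  by pat_completeness auto

termination
proof (relation "Wellfounded.measure label_measure", goal_cases)
  case (2 u)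
  have "label_measure u > 2 * length (pos_idx u)"
    by (rule label_measure_bound[of 1]) (simp_all add: pos_idx_def)
  with 2 label_measure_place[of "pos_idx u" "length u"] show ?case
    by (force simp: pos_idx_def)
next
  case (3 u)
  have "label_measure u > 2 * length (neg_idx u)"
    by (rule label_measure_bound[of "-1"]) (simp_all add: neg_idx_def)
  with 3 label_measure_place[of "neg_idx u" "length u"] show ?case
    by (force simp: neg_idx_def)
qed simp

declare label_tree.simps [simp del]

definition Ulist :: "nat \<Rightarrow> int list list" where
  "Ulist N = preorder (label_tree (wvec N))"

text \<open>The vectors of \<open>U(N)\<close> are numbered from 1, so \<open>uvec N i\<close> is meant for \<open>1 \<le> i \<le> N - 1\<close>.\<close>

definition uvec :: "nat \<Rightarrow> nat \<Rightarrow> int list" where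
  "uvec N i = Ulist N ! (i - 1)"

definition skew :: "int list \<Rightarrow> bool" where
  "skew u \<longleftrightarrow> filter (\<lambda>x. x \<noteq> 0) u = [1, -1]"

text \<open>An \<open>n \<times> n\<close> matrix has index type \<open>'n\<close>, and a bijection \<open>e\<close> from \<open>'n\<close> onto
  \<open>{0, \<dots>, n - 1}\<close> gives the (0-based) position of an index. Thus the \<open>p\<close>-th entry of a vector \<open>v\<close> is
  \<open>v ! e p\<close>, and the antidiagonal consists of the \<open>(a, b)\<close> with \<open>e a + e b = n - 1\<close>.\<close>

definition Vbar :: "nat \<Rightarrow> ('n::finite \<Rightarrow> nat) \<Rightarrow> (real^'n^'n) set" where
  "Vbar n e = {X. (\<forall>a. (\<Sum>b\<in>UNIV. X $ a $ b) = 0) \<and> (\<forall>b. (\<Sum>a\<in>UNIV. X $ a $ b) = 0) \<and>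
     (\<Sum>a\<in>UNIV. X $ a $ a) = 0 \<and> (\<Sum>(a, b) | e a + e b = n - 1. X $ a $ b) = 0}"

text \<open>Polymorphic in the entries: the real matrix is wanted for the basis, the integer matrix for
  the traces \<open>\<ell>\<^sub>i\<close>.\<close>

definition outer :: "('n::finite \<Rightarrow> nat) \<Rightarrow> int list \<Rightarrow> int list \<Rightarrow> 'a::ring_1^'n^'n" where
  "outer e u v = (\<chi> p q. of_int (u ! e p) * of_int (v ! e q))"

definition xmat :: "nat \<Rightarrow> ('n::finite \<Rightarrow> nat) \<Rightarrow> nat \<Rightarrow> real^'n^'n" where
  "xmat n e j = (let u = filter skew (Ulist n) ! (j - 1) in outer e u u)"

definition ymat :: "nat \<Rightarrow> ('n::finite \<Rightarrow> nat) \<Rightarrow> nat \<Rightarrow> 'a::ring_1^'n^'n" where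
  "ymat n e j = (let u = filter (\<lambda>u. \<not> skew u) (Ulist n) ! (j - 1) in outer e u u)"

definition xbar :: "nat \<Rightarrow> ('n::finite \<Rightarrow> nat) \<Rightarrow> nat \<Rightarrow> real^'n^'n" where
  "xbar n e i = (let k = n div 2 in
     \<Sum>j = 1..k. real_of_int (uvec k i ! (j - 1)) *\<^sub>R xmat n e j)"

definition ell :: "nat \<Rightarrow> ('n::finite \<Rightarrow> nat) \<Rightarrow> nat \<Rightarrow> int" where
  "ell n e i = trace (ymat n e i)"

definition ell_lcm :: "nat \<Rightarrow> ('n::finite \<Rightarrow> nat) \<Rightarrow> int" where
  "ell_lcm n e = Lcm (ell n e ` {1..(n - 1) div 2})"

definition ybar :: "nat \<Rightarrow> ('n::finite \<Rightarrow> nat) \<Rightarrow> nat \<Rightarrow> real^'n^'n" where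
  "ybar n e i = (let k' = (n - 1) div 2 in
     \<Sum>j = 1..k'. (real_of_int (ell_lcm n e) / real_of_int (ell n e j)
                   * real_of_int (uvec k' i ! (j - 1))) *\<^sub>R ymat n e j)"

definition basis_set :: "nat \<Rightarrow> ('n::finite \<Rightarrow> nat) \<Rightarrow> (real^'n^'n) set" where
  "basis_set n e =
     {outer e (uvec n i) (uvec n j) | i j. i \<in> {1..n - 1} \<and> j \<in> {1..n - 1} \<and> i \<noteq> j}
     \<union> xbar n e ` {1..n div 2 - 1}
     \<union> ybar n e ` {1..(n - 1) div 2 - 1}"

definition orthogonal_basis :: "'a::euclidean_space set \<Rightarrow> 'a set \<Rightarrow> bool" where
  "orthogonal_basis B V \<longleftrightarrow> pairwise orthogonal B \<and> independent B \<and> span B = V"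

end

theory Submission
  imports Defs
begin

text \<open>The labels of the tree form an orthogonal basis of the sum-zero vectors: each label takes one
  value on its positive and one on its negative support, whereas all labels further down have sum zero
  and are supported in one of these two sets. All labels are eigenvectors of the reversal of
  coordinates, with eigenvalue \<open>-1\<close> for the skew-symmetric ones and \<open>1\<close> for the others. Hence a matrix
  with zero row and column sums is a combination of the \<open>u\<^sup>i u\<^sup>j\<close>, its trace is the sum of the diagonal
  coefficients times the squared norms, and its antidiagonal sum is the same with a sign \<open>-1\<close> at the
  skew-symmetric labels. So both vanish iff the weighted diagonal coefficients sum to zero separately
  over the skew-symmetric and over the symmetric labels, and \<open>U(k)\<close> and \<open>U(k')\<close> provide orthogonal
  bases for these two spaces of coefficients.\<close>

section \<open>The vectors \<open>wvec r\<close>: values, sum and symmetry\<close>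

text \<open>Reading the indices modulo \<open>r div 2\<close> runs through the half-length vector
  twice. As a concatenation, the recursion passes value sets, sums and symmetry from
  \<open>r div 2\<close> to \<open>r\<close> directly.\<close>

lemma wvec_even:
  assumes "even r" "r > 4"
  shows "wvec r = wvec (r div 2) @ wvec (r div 2)"
proof (rule nth_equalityI)
  show "length (wvec r) = length (wvec (r div 2) @ wvec (r div 2))"
    using assms by auto
  fix i assume "i < length (wvec r)"
  then have i: "i < r" by simp
  have "wvec r ! i = wvec (r div 2) ! (i mod (r div 2))"
    using assms i by (subst wvec.simps) auto
  moreover have "i mod (r div 2) = (if i < r div 2 then i else i - r div 2)"
  proof -
    have "i - r div 2 < r div 2" using i assms by presburger
    then show ?thesis by (simp add: le_mod_geq)
  qed
  ultimately show "wvec r ! i = (wvec (r div 2) @ wvec (r div 2)) ! i"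
    by (simp add: nth_append)
qed

lemma wvec_odd:
  "wvec (2 * m + 1) = map (\<lambda>i. if even i then int m else - (int m + 1)) [0..<2 * m + 1]"
  by (subst wvec.simps) auto

lemma wvec_2: "wvec 2 = [1, -1]" and wvec_4: "wvec 4 = [1, -1, -1, 1]"
  by (subst wvec.simps, simp)+

lemma wvec_cases [consumes 1, case_names two four odd even]:
  assumes "r \<ge> 2"
    and "r = 2 \<Longrightarrow> thesis" "r = 4 \<Longrightarrow> thesis"
    and "\<And>m. r = 2 * m + 1 \<Longrightarrow> m \<ge> 1 \<Longrightarrow> thesis"
    and "\<And>m. r = 2 * m \<Longrightarrow> m \<ge> 3 \<Longrightarrow> wvec r = wvec m @ wvec m \<Longrightarrow> thesis"
  shows thesis
proof (cases "even r")
  case True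
  then obtain m where m: "r = 2 * m" by (elim evenE)
  consider "m = 1" | "m = 2" | "m \<ge> 3" using m assms(1) by linarith
  then show ?thesis
  proof cases
    case 3
    then show ?thesis using wvec_even[of r] m by (intro assms(5)[of m]) auto
  qed (use m assms in auto)
next
  case False
  then obtain m where "r = 2 * m + 1" by (elim oddE)
  with assms show ?thesis by (cases "m = 0") auto
qed

text \<open>A single positive and a single negative value is what later makes a label orthogonal to
  everything below it in the tree. Doubling keeps the set of values, so only the base cases and odd
  \<open>r\<close> produce new ones.\<close>

lemma wvec_two_valued:
  assumes "r \<ge> 2"
  shows "\<exists>p>0. \<exists>q>0. set (wvec r) \<subseteq> {p, - q}"
  using assms
proof (induction r rule: less_induct)
  case (less r)
  from less.prems show ?case
  proof (cases r rule: wvec_cases)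
    case two
    then show ?thesis by (intro exI[of _ 1]) (auto simp: wvec_2)
  next
    case four
    then show ?thesis by (intro exI[of _ 1]) (auto simp: wvec_4)
  next
    case (odd m)
    then show ?thesis
      by (intro exI[of _ "int m"] conjI exI[of _ "int m + 1"]) (auto simp: wvec_odd[simplified])
  next
    case (even m)
    then show ?thesis using less.IH[of m] by simp
  qed
qed

lemma sum_list_alternating:
  fixes a b :: int
  shows "sum_list (map (\<lambda>i. if even i then a else b) [0..<2 * m + 1]) = (int m + 1) * a + int m * b"
  by (induction m) (auto simp: algebra_simps)

lemma sum_list_wvec:
  assumes "r \<ge> 2"
  shows "sum_list (wvec r) = 0"
  using assms
proof (induction r rule: less_induct)
  case (less r)
  from less.prems show ?case
  proof (cases r rule: wvec_cases)
    case (odd m)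
    then show ?thesis unfolding odd wvec_odd sum_list_alternating by (simp add: algebra_simps)
  next
    case (even m)
    then show ?thesis using less.IH[of m] by simp
  qed (simp_all add: wvec_2 wvec_4)
qed

text \<open>For odd \<open>r\<close> the positions \<open>i\<close> and \<open>r - 1 - i\<close>
  have the same parity, and a palindrome written twice is a palindrome. The recursion descends only
  to \<open>m >= 3\<close>, hence never to \<open>wvec 2\<close>, the one vector that reversal
  negates.\<close>

lemma rev_wvec:
  assumes "r \<ge> 2" "r \<noteq> 2"
  shows "rev (wvec r) = wvec r"
  using assms
proof (induction r rule: less_induct)
  case (less r)
  from less.prems(1) show ?case
  proof (cases r rule: wvec_cases)
    case (odd m)
    show ?thesis unfolding odd wvec_odd
      by (rule nth_equalityI) (auto simp: rev_nth simp del: upt_Suc)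
  next
    case (even m)
    then show ?thesis using less.IH[of m] by simp
  qed (use less.prems in \<open>simp_all add: wvec_4\<close>)
qed

section \<open>Vectors placed on a strictly increasing list of indices\<close>

lemma length_place [simp]: "length (place N is v) = N"
  by (simp add: place_def)

lemma place_nth:
  assumes "distinct is" "set is \<subseteq> {..<N}" "length v = length is" "r < length is"
  shows "place N is v ! (is ! r) = v ! r"
proof -
  have "map_of (zip is v) (is ! r) = Some (v ! r)"
    using assms by (intro map_of_zip_nth) auto
  moreover have "is ! r < N" using assms nth_mem by blast
  ultimately show ?thesis by (simp add: place_def)
qed

lemma place_outside:
  assumes "i < N" "i \<notin> set is"
  shows "place N is v ! i = 0"
proof -
  have "map_of (zip is v) i = None"
    using assms by (metis map_of_SomeD not_None_eq set_zip_leftD)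
  then show ?thesis using assms by (simp add: place_def)
qed

text \<open>The positions of nonzero entries, listed increasingly, are exactly \<open>is\<close>, so
  the entries of \<open>v\<close> reappear in their own order. This lets \<open>skew\<close> be
  decided on \<open>v\<close> instead of the placed vector.\<close>

lemma filter_place:
  assumes "sorted_wrt (<) is" "set is \<subseteq> {..<N}" "length v = length is" "0 \<notin> set v"
  shows "filter (\<lambda>x. x \<noteq> 0) (place N is v) = v"
proof -
  let ?u = "place N is v"
  have d: "distinct is" using assms(1) strict_sorted_iff by blast
  note nth = place_nth[OF d assms(2,3)]
  have "?u ! i \<noteq> 0 \<longleftrightarrow> i \<in> set is" if "i < N" for i
  proof
    show "i \<in> set is" if "?u ! i \<noteq> 0" using that \<open>i < N\<close> place_outside by blast
    show "?u ! i \<noteq> 0" if "i \<in> set is"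
      using that nth assms(3,4) by (metis in_set_conv_nth)
  qed
  then have "filter (\<lambda>i. ?u ! i \<noteq> 0) [0..<N] = is"
    using assms(1,2) by (intro strict_sorted_equal) (auto simp: sorted_wrt_filter)
  moreover have "map ((!) ?u) is = v"
    using nth assms(3) by (intro nth_equalityI) auto
  moreover have "filter (\<lambda>x. x \<noteq> 0) ?u = filter (\<lambda>x. x \<noteq> 0) (map ((!) ?u) [0..<N])"
    by (metis length_place map_nth)
  ultimately show ?thesis by (simp add: filter_map o_def)
qed

text \<open>The reflection is order-reversing and permutes the index set. The reversed list of
  reflected indices is therefore strictly increasing with the same elements as \<open>is\<close>,
  and so equals \<open>is\<close>.\<close>

lemma strict_sorted_reflect:
  fixes N :: nat
  assumes "sorted_wrt (<) is" "set is \<subseteq> {..<N}" "\<And>i. i \<in> set is \<Longrightarrow> N - 1 - i \<in> set is"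
    and "r < length is"
  shows "is ! (length is - 1 - r) = N - 1 - is ! r"
proof -
  let ?js = "rev (map (\<lambda>i. N - 1 - i) is)"
  have "(\<lambda>i. N - 1 - i) ` set is = set is"
  proof
    show "set is \<subseteq> (\<lambda>i. N - 1 - i) ` set is"
    proof
      fix i assume i: "i \<in> set is"
      with assms(2) have "i < N" by blast
      then have "i = N - 1 - (N - 1 - i)" by simp
      with i show "i \<in> (\<lambda>i. N - 1 - i) ` set is" using assms(3) by blast
    qed
  qed (use assms(3) in auto)
  moreover have "sorted_wrt (<) ?js"
    unfolding sorted_wrt_rev sorted_wrt_map
  proof (rule sorted_wrt_mono_rel[OF _ assms(1)])
    fix x y assume "x \<in> set is" "y \<in> set is" "x < y"
    moreover from this have "y < N" using assms(2) by auto
    ultimately show "N - 1 - y < N - 1 - x" by linarith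
  qed
  ultimately have "?js = is"
    using assms(1) by (intro strict_sorted_equal) auto
  then have "is ! (length is - 1 - r) = ?js ! (length is - 1 - r)" by simp
  also have "\<dots> = N - 1 - is ! r" using assms(4) by (simp add: rev_nth)
  finally show ?thesis .
qed

section \<open>The label tree as a recursive splitting of index sets\<close>

text \<open>The sets that occur as supports of tree labels are invariant under the reflection
  \<open>i \<mapsto> N - 1 - i\<close>, so a label splits its support either into the two points of a reflection orbit
  or into two smaller invariant sets.\<close>

inductive splitting :: "nat \<Rightarrow> nat set \<Rightarrow> int list list \<Rightarrow> bool" for N where
  centre: "2 * i + 1 = N \<Longrightarrow> splitting N {i} []"
| pair: "i < j \<Longrightarrow> i + j + 1 = N \<Longrightarrow> length u = N \<Longrightarrow> skew u \<Longrightarrow> u ! i = 1 \<Longrightarrow> u ! j = -1 \<Longrightarrow>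
    (\<And>l. l < N \<Longrightarrow> l \<noteq> i \<Longrightarrow> l \<noteq> j \<Longrightarrow> u ! l = 0) \<Longrightarrow> splitting N {i, j} [u]"
| node: "splitting N P us \<Longrightarrow> splitting N Q vs \<Longrightarrow> P \<inter> Q = {} \<Longrightarrow> length u = N \<Longrightarrow> \<not> skew u \<Longrightarrow>
    (\<And>l. l < N \<Longrightarrow> u ! (N - 1 - l) = u ! l) \<Longrightarrow> p > 0 \<Longrightarrow> q > 0 \<Longrightarrow>
    (\<And>l. l \<in> P \<Longrightarrow> u ! l = p) \<Longrightarrow> (\<And>l. l \<in> Q \<Longrightarrow> u ! l = - q) \<Longrightarrow>
    (\<And>l. l < N \<Longrightarrow> l \<notin> P \<union> Q \<Longrightarrow> u ! l = 0) \<Longrightarrow>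
    int (card P) * p = int (card Q) * q \<Longrightarrow> splitting N (P \<union> Q) (u # us @ vs)"

text \<open>The empty list stands for the absent child when fewer than two indices are left, so the
  recursion treats present and absent children alike.\<close>

definition labels :: "nat \<Rightarrow> nat list \<Rightarrow> int list list" where
  "labels N is =
     (if length is < 2 then [] else preorder (label_tree (place N is (wvec (length is)))))"

lemma labels_rec:
  assumes "length is \<ge> 2" "u = place N is (wvec (length is))"
  shows "labels N is = u # labels N (pos_idx u) @ labels N (neg_idx u)"
proof -
  have "length u = N" by (simp add: assms(2))
  have "labels N is = preorder (label_tree u)" using assms by (simp add: labels_def)
  also have "\<dots> = u # labels N (pos_idx u) @ labels N (neg_idx u)"
    by (subst label_tree.simps) (simp add: labels_def \<open>length u = N\<close>)
  finally show ?thesis .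
qed

text \<open>Induction on the number of indices. A single invariant index is the fixed point of the
  reflection, and two are exchanged by it. From three on, the label is symmetric under the
  reflection, so its positive and negative supports are again invariant and both are
  smaller.\<close>

lemma splitting_labels:
  assumes "sorted_wrt (<) is" "set is \<subseteq> {..<N}" "\<And>i. i \<in> set is \<Longrightarrow> N - 1 - i \<in> set is" "is \<noteq> []"
  shows "splitting N (set is) (labels N is)"
  using assms
proof (induction "length is" arbitrary: "is" rule: less_induct)
  case (less "is")
  note srt = less.prems(1) and sub = less.prems(2) and refl = less.prems(3)
  have d: "distinct is" using srt strict_sorted_iff by blast
  let ?r = "length is"
  define u where "u = place N is (wvec ?r)"
  have at: "u ! (is ! l) = wvec ?r ! l" if "l < ?r" for l
    unfolding u_def using that by (intro place_nth[OF d sub]) auto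
  have out: "u ! l = 0" if "l < N" "l \<notin> set is" for l
    unfolding u_def using that by (rule place_outside)
  have lenu: "length u = N" by (simp add: u_def)
  note mirror = strict_sorted_reflect[OF srt sub refl]
  consider "?r = 1" | "?r = 2" | "?r \<ge> 3"
    using less.prems(4) by (metis One_nat_def Suc_leI le_neq_implies_less length_greater_0_conv
        numeral_2_eq_2 numeral_3_eq_3)
  then show ?case
  proof cases
    case 1
    then obtain i where i: "is = [i]" by (auto simp: length_Suc_conv)
    with sub refl[of i] have "2 * i + 1 = N" by auto
    with i show ?thesis by (simp add: labels_def splitting.centre)
  next
    case 2
    then obtain i j where ij: "is = [i, j]" by (auto simp: length_Suc_conv numeral_2_eq_2)
    with srt sub have lt: "i < j" "j < N" by auto
    have w: "wvec ?r = [1, -1]" using 2 wvec_2 by simp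
    have ui: "u ! i = 1" "u ! j = -1" using at[of 0] at[of 1] unfolding w by (auto simp: ij)
    have uo: "u ! l = 0" if "l < N" "l \<noteq> i" "l \<noteq> j" for l using out that ij by simp
    have pi: "pos_idx u = [i]"
      unfolding pos_idx_def lenu
      using ui uo lt by (intro strict_sorted_equal) (auto simp: sorted_wrt_filter, force)
    have ni: "neg_idx u = [j]"
      unfolding neg_idx_def lenu
      using ui uo lt by (intro strict_sorted_equal) (auto simp: sorted_wrt_filter, force)
    have "labels N is = u # labels N [i] @ labels N [j]"
      using labels_rec[OF _ u_def] 2 unfolding pi ni by auto
    also have "\<dots> = [u]" by (simp add: labels_def)
    finally have "labels N is = [u]" .
    moreover have "skew u"
      unfolding skew_def u_def using 2 wvec_2 by (subst filter_place[OF srt sub]) auto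
    moreover have "i + j + 1 = N" using mirror[of 0] ij lt by auto
    ultimately show ?thesis
      using splitting.pair[of i j N u, OF lt(1) _ lenu _ ui uo] ij by simp
  next
    case 3
    then have r2: "?r \<ge> 2" by simp
    from wvec_two_valued[OF r2] obtain p q
      where pq: "p > 0" "q > 0" "set (wvec ?r) \<subseteq> {p, - q}"
      by metis
    let ?P = "set (pos_idx u)" and ?Q = "set (neg_idx u)"
    have Pdef: "?P = {i. i < N \<and> u ! i > 0}" and Qdef: "?Q = {i. i < N \<and> u ! i < 0}"
      by (auto simp: pos_idx_def neg_idx_def lenu)
    have val: "u ! l = p \<or> u ! l = - q" if "l \<in> set is" for l
    proof -
      from that obtain k where k: "k < ?r" "is ! k = l" unfolding in_set_conv_nth by blast
      have "u ! l = wvec ?r ! k" using at[OF k(1)] unfolding k(2) .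
      also have "\<dots> \<in> set (wvec ?r)" by (rule nth_mem) (simp add: k(1))
      finally have "u ! l \<in> set (wvec ?r)" .
      with pq(3) have "u ! l \<in> {p, - q}" by (rule subsetD)
      then show ?thesis by simp
    qed
    have un: "set is = ?P \<union> ?Q"
      using val pq(1,2) sub out unfolding Pdef Qdef by force
    have uP: "u ! l = p" if "l \<in> ?P" for l
      using that val[of l] un pq unfolding Pdef by auto
    have uQ: "u ! l = - q" if "l \<in> ?Q" for l
      using that val[of l] un pq unfolding Qdef by auto
    \<comment> \<open>The reflection reverses ranks within \<open>is\<close>, so the symmetry of the
      label is the palindrome property of \<open>wvec\<close>, available because the length is not
      2.\<close>
    have pal: "u ! (N - 1 - l) = u ! l" if "l < N" for l
    proof (cases "l \<in> set is")
      case True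
      then obtain k where k: "k < ?r" "is ! k = l" unfolding in_set_conv_nth by blast
      have "N - 1 - l = is ! (?r - 1 - k)" using mirror[OF _ k(1)] by (simp only: k(2))
      then have "u ! (N - 1 - l) = wvec ?r ! (?r - 1 - k)"
        using at[of "?r - 1 - k"] k(1) by simp
      also have "\<dots> = rev (wvec ?r) ! k" using k(1) by (simp add: rev_nth)
      also have "\<dots> = u ! l" using rev_wvec[OF r2] 3 at[OF k(1)] unfolding k(2) by simp
      finally show ?thesis .
    next
      case False
      have "N - 1 - l \<notin> set is"
      proof
        assume "N - 1 - l \<in> set is"
        from refl[OF this] that False show False by simp
      qed
      with False that show ?thesis by (simp add: out)
    qed
    \<comment> \<open>The nonzero entries of the label form all of \<open>wvec ?r\<close>, which has
      at least three entries and so differs from \<open>[1, -1]\<close>.\<close>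
    have "0 \<notin> set (wvec ?r)" using pq by auto
    then have "filter (\<lambda>x. x \<noteq> 0) u = wvec ?r"
      unfolding u_def by (intro filter_place[OF srt sub]) auto
    moreover have "wvec ?r \<noteq> [1, -1]"
    proof
      assume "wvec ?r = [1, -1]"
      then have "length (wvec ?r) = 2" by simp
      with 3 show False by simp
    qed
    ultimately have nsk: "\<not> skew u" by (simp add: skew_def)
    have disj: "?P \<inter> ?Q = {}" unfolding Pdef Qdef by auto
    \<comment> \<open>Both signs occur, so neither half is empty; each is then a proper part of
      \<open>is\<close>, as the induction requires.\<close>
    obtain i j where ij: "i < ?r" "wvec ?r ! i > 0" "j < ?r" "wvec ?r ! j < 0"
      using wvec_mixed[of ?r] 3 by auto
    then have "is ! i \<in> ?P" "is ! j \<in> ?Q"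
      unfolding Pdef Qdef using at sub nth_mem by auto
    then have ne: "?P \<noteq> {}" "?Q \<noteq> {}" by (metis empty_iff)+
    have srtP: "sorted_wrt (<) (pos_idx u)" and srtQ: "sorted_wrt (<) (neg_idx u)"
      by (auto simp: pos_idx_def neg_idx_def sorted_wrt_filter)
    have dP: "length (pos_idx u) = card ?P" and dQ: "length (neg_idx u) = card ?Q"
      using srtP srtQ by (metis distinct_card strict_sorted_iff)+
    have cd: "?r = card ?P + card ?Q"
      using distinct_card[OF d] un disj by (simp add: card_Un_disjoint)
    have "card ?P > 0" "card ?Q > 0" using ne by (simp_all add: card_gt_0_iff)
    then have lt: "length (pos_idx u) < ?r" "length (neg_idx u) < ?r"
      using cd dP dQ by simp_all
    have "splitting N ?P (labels N (pos_idx u))"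
    proof (rule less.hyps[OF lt(1) srtP])
      show "?P \<subseteq> {..<N}" by (auto simp: Pdef)
      show "N - 1 - i \<in> ?P" if "i \<in> ?P" for i
        using that pal[of i] by (auto simp: Pdef)
      show "pos_idx u \<noteq> []" using ne(1) by simp
    qed
    moreover have "splitting N ?Q (labels N (neg_idx u))"
    proof (rule less.hyps[OF lt(2) srtQ])
      show "?Q \<subseteq> {..<N}" by (auto simp: Qdef)
      show "N - 1 - i \<in> ?Q" if "i \<in> ?Q" for i
        using that pal[of i] by (auto simp: Qdef)
      show "neg_idx u \<noteq> []" using ne(2) by simp
    qed
    \<comment> \<open>The balance of the two halves is the zero sum of \<open>wvec ?r\<close>,
      carried over to the positions in \<open>is\<close>.\<close>
    moreover have "int (card ?P) * p = int (card ?Q) * q"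
    proof -
      have "0 = sum_list (wvec ?r)" using sum_list_wvec[of ?r] 3 by simp
      also have "wvec ?r = map ((!) u) is" using at by (intro nth_equalityI) auto
      also have "sum_list \<dots> = (\<Sum>l\<in>set is. u ! l)" by (rule sum_list_distinct_conv_sum_set[OF d])
      also have "\<dots> = (\<Sum>l\<in>?P. u ! l) + (\<Sum>l\<in>?Q. u ! l)"
        unfolding un using disj by (intro sum.union_disjoint) auto
      also have "\<dots> = int (card ?P) * p - int (card ?Q) * q"
        by (simp add: uP uQ sum_negf)
      finally show ?thesis by simp
    qed
    moreover have "u ! l = 0" if "l < N" "l \<notin> ?P \<union> ?Q" for l
      using out that un by blast
    ultimately have "splitting N (?P \<union> ?Q) (u # labels N (pos_idx u) @ labels N (neg_idx u))"
      by (intro splitting.node[OF _ _ disj lenu nsk pal pq(1,2) uP uQ])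
    moreover have "labels N is = u # labels N (pos_idx u) @ labels N (neg_idx u)"
      using labels_rec[of "is" u N] 3 by (simp add: u_def)
    ultimately show ?thesis using un by simp
  qed
qed

text \<open>The root is \<open>wvec N\<close> placed on all indices, and the full index range is
  invariant under the reflection.\<close>

lemma splitting_Ulist:
  assumes "N \<ge> 2"
  shows "splitting N {..<N} (Ulist N)"
proof -
  have "place N [0..<N] (wvec N) = wvec N"
    using place_nth[of "[0..<N]" N "wvec N"]
    by (intro nth_equalityI) (auto simp: atLeast0LessThan)
  then have "Ulist N = labels N [0..<N]"
    using assms by (simp add: Ulist_def labels_def)
  with splitting_labels[of "[0..<N]" N] assms show ?thesis
    by (simp add: atLeast0LessThan)
qed

section \<open>Orthogonality, counting and reflection behaviour of the labels\<close>

definition idot :: "nat \<Rightarrow> int list \<Rightarrow> int list \<Rightarrow> int" where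
  "idot N u v = (\<Sum>i<N. u ! i * v ! i)"

lemma idot_commute: "idot N u v = idot N v u"
  by (simp add: idot_def mult.commute)

lemma splitting_subset: "splitting N P us \<Longrightarrow> P \<subseteq> {..<N}"
  by (induction rule: splitting.induct) auto

lemma splitting_finite: "splitting N P us \<Longrightarrow> finite P"
  by (rule finite_subset[OF splitting_subset]) auto

lemma splitting_outside: "splitting N P us \<Longrightarrow> u \<in> set us \<Longrightarrow> l < N \<Longrightarrow> l \<notin> P \<Longrightarrow> u ! l = 0"
  by (induction arbitrary: u rule: splitting.induct) auto

lemma splitting_sum:
  assumes "splitting N P us" "u \<in> set us"
  shows "(\<Sum>l<N. u ! l) = 0"
  using assms
proof (induction arbitrary: u rule: splitting.induct)
  case (pair i j v)
  then have "(\<Sum>l<N. u ! l) = (\<Sum>l\<in>{i, j}. u ! l)"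
    by (intro sum.mono_neutral_right) auto
  with pair show ?case by auto
next
  case (node P us Q vs v p q)
  show ?case
  proof (cases "u = v")
    case True
    have "(\<Sum>l<N. v ! l) = (\<Sum>l\<in>P \<union> Q. v ! l)"
      using splitting_subset[OF node(1)] splitting_subset[OF node(2)] node.hyps(11)
      by (intro sum.mono_neutral_right) auto
    also have "\<dots> = (\<Sum>l\<in>P. v ! l) + (\<Sum>l\<in>Q. v ! l)"
      using splitting_finite[OF node(1)] splitting_finite[OF node(2)] node.hyps(3)
      by (intro sum.union_disjoint)
    also have "\<dots> = 0" using node.hyps(9,10,12) by (simp add: sum_negf)
    finally show ?thesis using True by simp
  qed (use node in auto)
qed auto

lemma splitting_nonzero:
  assumes "splitting N P us" "u \<in> set us"
  shows "\<exists>l<N. u ! l \<noteq> 0"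
  using assms
proof (induction arbitrary: u rule: splitting.induct)
  case (pair i j v)
  then show ?case by (intro exI[of _ i]) auto
next
  case (node P us Q vs v p q)
  have "\<exists>l. l \<in> P" using node(1) by (induction rule: splitting.induct) auto
  then obtain l where "l \<in> P" ..
  then have "l < N" "v ! l \<noteq> 0" using splitting_subset[OF node(1)] node.hyps(7,9) by auto
  with node show ?case by auto
qed auto

lemma idot_self_pos:
  assumes "\<exists>l<N. u ! l \<noteq> 0"
  shows "idot N u u > 0"
proof -
  obtain l where "l < N" "u ! l \<noteq> 0" using assms by blast
  then show ?thesis unfolding idot_def by (intro sum_pos2[of _ l]) (auto simp: zero_less_mult_iff)
qed

text \<open>Off \<open>P\<close> the products vanish together with \<open>v\<close>, so
  \<open>u\<close> can be replaced by the constant \<open>c\<close> throughout, which leaves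
  \<open>c\<close> times the zero sum of \<open>v\<close>.\<close>

lemma idot_constant_left:
  assumes "\<And>l. l \<in> P \<Longrightarrow> u ! l = c" "\<And>l. l < N \<Longrightarrow> l \<notin> P \<Longrightarrow> v ! l = 0" "(\<Sum>l<N. v ! l) = 0"
  shows "idot N u v = 0"
proof -
  have "idot N u v = (\<Sum>l<N. c * v ! l)"
    unfolding idot_def using assms(1,2) by (intro sum.cong refl) (metis lessThan_iff mult_zero_right)
  also have "\<dots> = 0" using assms(3) by (simp flip: sum_distrib_left)
  finally show ?thesis .
qed

text \<open>A label is constant on each half, while a label below it has zero sum and lives in one
  half; labels from different halves have disjoint supports. The claim is made for positions in the
  list, because distinctness of the entries is only derived from it.\<close>

lemma splitting_orthogonal:
  assumes "splitting N P us"
  shows "sorted_wrt (\<lambda>u v. idot N u v = 0) us"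
  using assms
proof (induction rule: splitting.induct)
  case (node P us Q vs v p q)
  have "idot N v u = 0" if "u \<in> set us" for u
    using idot_constant_left[OF node.hyps(9)] splitting_outside[OF node(1) that]
      splitting_sum[OF node(1) that] by blast
  moreover have "idot N v u = 0" if "u \<in> set vs" for u
    using idot_constant_left[OF node.hyps(10)] splitting_outside[OF node(2) that]
      splitting_sum[OF node(2) that] by blast
  moreover have "idot N x y = 0" if "x \<in> set us" "y \<in> set vs" for x y
    unfolding idot_def
  proof (intro sum.neutral ballI)
    fix l assume "l \<in> {..<N}"
    with splitting_outside[OF node(1) that(1), of l] splitting_outside[OF node(2) that(2), of l]
      node.hyps(3) show "x ! l * y ! l = 0" by auto
  qed
  ultimately show ?case using node.IH by (auto simp: sorted_wrt_append)
qed auto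

text \<open>A vector occurring at two positions would be orthogonal to itself, although all labels
  are nonzero.\<close>

lemma splitting_distinct:
  assumes "splitting N P us"
  shows "distinct us"
  unfolding distinct_conv_nth
proof (intro allI impI)
  fix i j assume ij: "i < length us" "j < length us" "i \<noteq> j"
  have "idot N (us ! i) (us ! j) = 0"
    using splitting_orthogonal[OF assms] ij idot_commute
    unfolding sorted_wrt_iff_nth_less by (metis linorder_neqE_nat)
  moreover have "idot N (us ! i) (us ! i) > 0"
    using splitting_nonzero[OF assms] ij by (intro idot_self_pos) auto
  ultimately show "us ! i \<noteq> us ! j" by auto
qed

lemma splitting_orthogonal_set:
  assumes "splitting N P us" "u \<in> set us" "v \<in> set us" "u \<noteq> v"
  shows "idot N u v = 0"
  using splitting_orthogonal[OF assms(1)] assms(2-) idot_commute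
  unfolding sorted_wrt_iff_nth_less by (metis in_set_conv_nth linorder_neqE_nat)

lemma splitting_length:
  assumes "splitting N P us"
  shows "length us + 1 = card P"
  using assms
proof (induction rule: splitting.induct)
  case (node P us Q vs v p q)
  then have "card (P \<union> Q) = card P + card Q"
    using splitting_finite by (intro card_Un_disjoint) auto
  with node.IH show ?case by simp
qed auto

text \<open>The reflection pairs up all indices except its fixed point. Two disjoint halves cannot
  both contain that point, so at most one of them has odd size.\<close>

lemma splitting_odd_card:
  assumes "splitting N P us"
  shows "odd (card P) \<longleftrightarrow> (\<exists>i\<in>P. 2 * i + 1 = N)"
  using assms
proof (induction rule: splitting.induct)
  case (node P us Q vs v p q)
  then have "card (P \<union> Q) = card P + card Q"
    using splitting_finite by (intro card_Un_disjoint) auto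
  moreover have "\<not> ((\<exists>i\<in>P. 2 * i + 1 = N) \<and> (\<exists>i\<in>Q. 2 * i + 1 = N))"
  proof
    assume "(\<exists>i\<in>P. 2 * i + 1 = N) \<and> (\<exists>i\<in>Q. 2 * i + 1 = N)"
    then obtain i j where "i \<in> P" "j \<in> Q" "2 * i + 1 = N" "2 * j + 1 = N" by blast
    moreover from this have "i = j" by linarith
    ultimately show False using node.hyps(3) by blast
  qed
  ultimately show ?case using node.IH by auto
qed auto

text \<open>Each exchanged pair of indices contributes one skew label. Rounding down is additive
  over the two halves because they are not both odd.\<close>

lemma splitting_count_skew:
  assumes "splitting N P us"
  shows "length (filter skew us) = card P div 2"
  using assms
proof (induction rule: splitting.induct)
  case (node P us Q vs v p q)
  then have "card (P \<union> Q) = card P + card Q"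
    using splitting_finite by (intro card_Un_disjoint) auto
  moreover have "\<not> (odd (card P) \<and> odd (card Q))"
  proof
    assume "odd (card P) \<and> odd (card Q)"
    then obtain i j where "i \<in> P" "j \<in> Q" "2 * i + 1 = N" "2 * j + 1 = N"
      using splitting_odd_card[OF node(1)] splitting_odd_card[OF node(2)] by blast
    moreover from this have "i = j" by linarith
    ultimately show False using node.hyps(3) by blast
  qed
  then have "(card P + card Q) div 2 = card P div 2 + card Q div 2" by presburger
  ultimately show ?case using node.IH node.hyps(5) by simp
qed auto

lemma splitting_skew_norm:
  assumes "splitting N P us" "u \<in> set us" "skew u"
  shows "idot N u u = 2"
  using assms
proof (induction arbitrary: u rule: splitting.induct)
  case (pair i j v)
  then have "idot N u u = (\<Sum>l\<in>{i, j}. u ! l * u ! l)"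
    unfolding idot_def by (intro sum.mono_neutral_right) auto
  with pair show ?case by auto
qed auto

lemma splitting_reflect:
  assumes "splitting N P us" "u \<in> set us" "l < N"
  shows "u ! (N - 1 - l) = (if skew u then -1 else 1) * u ! l"
  using assms
proof (induction arbitrary: u rule: splitting.induct)
  case (pair i j v)
  consider "l = i" | "l = j" | "l \<noteq> i" "l \<noteq> j" by blast
  then show ?case
  proof cases
    case 1
    then have "N - 1 - l = j" using pair by linarith
    with 1 pair show ?thesis by simp
  next
    case 2
    then have "N - 1 - l = i" using pair by linarith
    with 2 pair show ?thesis by simp
  next
    case 3
    then have "N - 1 - l \<noteq> i" "N - 1 - l \<noteq> j" "N - 1 - l < N" using pair by linarith+
    with 3 pair show ?thesis by simp
  qed
qed auto

section \<open>Completeness of the labels among sum-zero vectors\<close>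

text \<open>At a node, the zero sum and orthogonality to the root label give two linear equations
  for the sums of \<open>f\<close> over the two halves. Their determinant is nonzero since
  \<open>p + q > 0\<close>, so both sums vanish and the hypotheses descend to each half.\<close>

lemma splitting_complete:
  fixes f :: "nat \<Rightarrow> real"
  assumes "splitting N P us" "(\<Sum>l\<in>P. f l) = 0" "\<And>u. u \<in> set us \<Longrightarrow> (\<Sum>l\<in>P. f l * real_of_int (u ! l)) = 0"
    and "l \<in> P"
  shows "f l = 0"
  using assms
proof (induction arbitrary: l rule: splitting.induct)
  case (pair i j v)
  then have "f i + f j = 0" "f i - f j = 0" by auto
  with pair show ?case by auto
next
  case (node P us Q vs v p q)
  have un: "(\<Sum>l\<in>P \<union> Q. g l) = (\<Sum>l\<in>P. g l) + (\<Sum>l\<in>Q. g l)" for g :: "nat \<Rightarrow> real"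
    using splitting_finite[OF node(1)] splitting_finite[OF node(2)] node.hyps(3)
    by (intro sum.union_disjoint)
  define a b where "a = (\<Sum>l\<in>P. f l)" and "b = (\<Sum>l\<in>Q. f l)"
  have "(\<Sum>l\<in>P. f l * real_of_int (v ! l)) = a * p" "(\<Sum>l\<in>Q. f l * real_of_int (v ! l)) = - (b * q)"
    using node.hyps(9,10) by (simp_all add: a_def b_def sum_distrib_right sum_negf)
  then have "a * p - b * q = 0"
    using node.prems(2)[of v] un[of "\<lambda>l. f l * real_of_int (v ! l)"] by simp
  moreover have "a + b = 0" using node.prems(1) un[of f] by (simp add: a_def b_def)
  ultimately have "a * (p + q) = 0" by (auto simp: algebra_simps add_eq_0_iff)
  moreover have "real_of_int p + real_of_int q \<noteq> 0" using node.hyps(7,8) by linarith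
  ultimately have ab: "a = 0" "b = 0" using \<open>a + b = 0\<close> by auto
  have us: "(\<Sum>l\<in>P. f l * real_of_int (u ! l)) = 0" if "u \<in> set us" for u
  proof -
    have "(\<Sum>l\<in>Q. f l * real_of_int (u ! l)) = 0"
      using splitting_outside[OF node(1) that] splitting_subset[OF node(2)] node.hyps(3)
      by (intro sum.neutral) (simp add: disjoint_iff subset_eq, metis)
    with node.prems(2)[of u] un that show ?thesis by simp
  qed
  have vs: "(\<Sum>l\<in>Q. f l * real_of_int (u ! l)) = 0" if "u \<in> set vs" for u
  proof -
    have "(\<Sum>l\<in>P. f l * real_of_int (u ! l)) = 0"
      using splitting_outside[OF node(2) that] splitting_subset[OF node(1)] node.hyps(3)
      by (intro sum.neutral) (auto simp: disjoint_iff subset_eq)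
    with node.prems(2)[of u] un that show ?thesis by simp
  qed
  from node.prems(3) show ?case
  proof
    show "f l = 0" if "l \<in> P" using ab(1) us that unfolding a_def by (rule node.IH(1))
    show "f l = 0" if "l \<in> Q" using ab(2) vs that unfolding b_def by (rule node.IH(2))
  qed
qed auto

lemma uvec_image:
  assumes "N \<ge> 2"
  shows "uvec N ` {1..N - 1} = set (Ulist N)"
proof -
  have "length (Ulist N) = N - 1" using splitting_length[OF splitting_Ulist[OF assms]] by simp
  moreover have "{1..N - 1} = Suc ` {..<N - 1}" by (simp add: image_Suc_lessThan)
  ultimately show ?thesis
    by (auto simp: uvec_def[abs_def] set_conv_nth image_image)
qed

text \<open>Subtracting the orthogonal projection from \<open>f\<close> leaves a vector
  \<open>g\<close> with zero sum that is orthogonal to every label, and completeness makes it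
  zero.\<close>

lemma Ulist_expansion:
  fixes f :: "nat \<Rightarrow> real"
  assumes "N \<ge> 2" "(\<Sum>l<N. f l) = 0" "i < N"
  shows "f i = (\<Sum>u\<in>set (Ulist N). (\<Sum>l<N. f l * real_of_int (u ! l)) / real_of_int (idot N u u) * real_of_int (u ! i))"
proof -
  let ?U = "set (Ulist N)"
  note sp = splitting_Ulist[OF assms(1)]
  define c where "c u = (\<Sum>l<N. f l * real_of_int (u ! l)) / idot N u u" for u
  define g where "g l = f l - (\<Sum>u\<in>?U. c u * real_of_int (u ! l))" for l
  have "g i = 0"
  proof (rule splitting_complete[OF sp])
    have "(\<Sum>l<N. \<Sum>u\<in>?U. c u * real_of_int (u ! l)) = (\<Sum>u\<in>?U. c u * real_of_int (\<Sum>l<N. u ! l))"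
      by (subst sum.swap) (simp add: sum_distrib_left)
    also have "\<dots> = 0" using splitting_sum[OF sp] by (simp flip: of_int_sum)
    finally show "(\<Sum>l<N. g l) = 0" using assms(2) by (simp add: g_def sum_subtractf)
  next
    fix v assume v: "v \<in> ?U"
    have "(\<Sum>l<N. (\<Sum>u\<in>?U. c u * real_of_int (u ! l)) * real_of_int (v ! l)) = (\<Sum>u\<in>?U. c u * idot N u v)"
      unfolding sum_distrib_right idot_def of_int_sum sum_distrib_left
      by (subst sum.swap) (simp add: mult.assoc)
    also have "\<dots> = (\<Sum>u\<in>{v}. c u * idot N u v)"
      using v splitting_orthogonal_set[OF sp] by (intro sum.mono_neutral_right) auto
    also have "\<dots> = (\<Sum>l<N. f l * real_of_int (v ! l))"
      using idot_self_pos[OF splitting_nonzero[OF sp v]] by (simp add: c_def)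
    finally show "(\<Sum>l<N. g l * real_of_int (v ! l)) = 0"
      by (simp add: g_def left_diff_distrib sum_subtractf)
  qed (use assms in auto)
  then show ?thesis by (simp add: g_def c_def)
qed

section \<open>Outer products, trace, antidiagonal sum and the space \<open>Vbar\<close>\<close>

lemma sum_over_index:
  assumes "bij_betw e UNIV {..<n}"
  shows "(\<Sum>a\<in>UNIV. g (e a)) = (\<Sum>i<n. g i)"
  using sum.reindex_bij_betw[OF assms] .

lemma inner_outer:
  fixes e :: "'n::finite \<Rightarrow> nat"
  assumes "bij_betw e UNIV {..<n}"
  shows "(outer e u v :: real^'n^'n) \<bullet> outer e u' v' = real_of_int (idot n u u' * idot n v v')"
proof -
  have "(outer e u v :: real^'n^'n) \<bullet> outer e u' v' =
      (\<Sum>p\<in>UNIV. real_of_int (u ! e p * u' ! e p)) * (\<Sum>q\<in>UNIV. real_of_int (v ! e q * v' ! e q))"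
    by (simp add: inner_vec_def outer_def sum_product algebra_simps)
  also have "\<dots> = real_of_int (idot n u u' * idot n v v')"
    using sum_over_index[OF assms, of "\<lambda>i. real_of_int (u ! i * u' ! i)"]
      sum_over_index[OF assms, of "\<lambda>i. real_of_int (v ! i * v' ! i)"]
    by (simp add: idot_def)
  finally show ?thesis .
qed

lemma trace_outer:
  fixes e :: "'n::finite \<Rightarrow> nat"
  assumes "bij_betw e UNIV {..<n}"
  shows "trace (outer e u v :: 'a::ring_1^'n^'n) = of_int (idot n u v)"
  using sum_over_index[OF assms, of "\<lambda>i. of_int (u ! i * v ! i) :: 'a"]
  by (simp add: trace_def outer_def idot_def)

definition antitrace :: "nat \<Rightarrow> ('n::finite \<Rightarrow> nat) \<Rightarrow> real^'n^'n \<Rightarrow> real" where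
  "antitrace n e X = (\<Sum>(a, b) | e a + e b = n - 1. X $ a $ b)"

lemma linear_antitrace: "linear (antitrace n e)"
  by (rule linearI) (simp_all add: antitrace_def sum.distrib sum_distrib_left case_prod_beta)

lemma antitrace_outer:
  fixes e :: "'n::finite \<Rightarrow> nat"
  assumes "bij_betw e UNIV {..<n}"
  shows "antitrace n e (outer e u v) = real_of_int (\<Sum>i<n. u ! i * v ! (n - 1 - i))"
proof -
  \<comment> \<open>The reflection transported to the index type; the antidiagonal is the graph of
    this map.\<close>
  define r where "r a = inv e (n - 1 - e a)" for a
  have lt: "e a < n" for a using assms by (auto simp: bij_betw_def)
  have er: "e (r a) = n - 1 - e a" for a
  proof -
    have "n - 1 - e a \<in> range e" using assms lt[of a] by (auto simp: bij_betw_def)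
    then show ?thesis unfolding r_def by (rule f_inv_into_f)
  qed
  have inj: "inj e" using assms by (simp add: bij_betw_def)
  have "b = r a" if "e a + e b = n - 1" for a b
  proof -
    have "e b = e (r a)" using that er[of a] by linarith
    with inj show ?thesis by (simp add: inj_eq)
  qed
  moreover have "e a + e (r a) = n - 1" for a using lt[of a] er[of a] by linarith
  ultimately have S: "{(a, b). e a + e b = n - 1} = (\<lambda>a. (a, r a)) ` UNIV" by auto
  have "antitrace n e (outer e u v) = (\<Sum>a\<in>UNIV. real_of_int (u ! e a * v ! (n - 1 - e a)))"
    unfolding antitrace_def S by (subst sum.reindex) (auto simp: inj_on_def outer_def er)
  also have "\<dots> = (\<Sum>i<n. real_of_int (u ! i * v ! (n - 1 - i)))"
    by (rule sum_over_index[OF assms])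
  finally show ?thesis by simp
qed

lemma linear_trace: "linear (trace :: real^'n^'n \<Rightarrow> real)"
  by (rule linearI) (simp_all add: trace_def sum.distrib sum_distrib_left)

lemma Vbar_altdef:
  "Vbar n e = {X. (\<forall>a. (\<Sum>b\<in>UNIV. X $ a $ b) = 0) \<and> (\<forall>b. (\<Sum>a\<in>UNIV. X $ a $ b) = 0) \<and>
     trace X = 0 \<and> antitrace n e X = 0}"
  by (simp add: Vbar_def trace_def antitrace_def)

lemma subspace_Vbar: "subspace (Vbar n e)"
  unfolding subspace_def Vbar_altdef
  by (simp add: linear_0[OF linear_trace] linear_0[OF linear_antitrace] linear_add[OF linear_trace]
      linear_add[OF linear_antitrace] linear_cmul[OF linear_trace] linear_cmul[OF linear_antitrace]
      sum.distrib flip: sum_distrib_left)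

lemma uvec_mem:
  assumes "i \<in> {1..N - 1}"
  shows "uvec N i \<in> set (Ulist N)" "N \<ge> 2"
proof -
  show "N \<ge> 2" using assms by auto
  then show "uvec N i \<in> set (Ulist N)" using uvec_image[of N] assms by blast
qed

lemma Ulist_sum: "N \<ge> 2 \<Longrightarrow> u \<in> set (Ulist N) \<Longrightarrow> (\<Sum>l<N. u ! l) = 0"
  using splitting_sum[OF splitting_Ulist] by blast

lemma Ulist_pos: "N \<ge> 2 \<Longrightarrow> u \<in> set (Ulist N) \<Longrightarrow> idot N u u > 0"
  using idot_self_pos[OF splitting_nonzero[OF splitting_Ulist]] by blast

lemma Ulist_orthogonal:
  "N \<ge> 2 \<Longrightarrow> u \<in> set (Ulist N) \<Longrightarrow> v \<in> set (Ulist N) \<Longrightarrow> u \<noteq> v \<Longrightarrow> idot N u v = 0"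
  using splitting_orthogonal_set[OF splitting_Ulist] by blast

lemma Ulist_distinct: "N \<ge> 2 \<Longrightarrow> distinct (Ulist N)"
  using splitting_distinct[OF splitting_Ulist] by blast

lemma Ulist_length_skew: "N \<ge> 2 \<Longrightarrow> length (filter skew (Ulist N)) = N div 2"
  using splitting_count_skew[OF splitting_Ulist] by simp

lemma Ulist_length_symmetric:
  assumes "N \<ge> 2"
  shows "length (filter (\<lambda>u. \<not> skew u) (Ulist N)) = (N - 1) div 2"
proof -
  have "length (Ulist N) = N - 1" using splitting_length[OF splitting_Ulist[OF assms]] by simp
  then show ?thesis
    using sum_length_filter_compl[of skew "Ulist N"] Ulist_length_skew[OF assms] by linarith
qed

lemma outer_row_sum:
  assumes "bij_betw e UNIV {..<n}" "(\<Sum>i<n. v ! i) = 0"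
  shows "(\<Sum>b\<in>UNIV. outer e u v $ a $ b) = (0 :: real)"
  using sum_over_index[OF assms(1), of "\<lambda>i. real_of_int (v ! i)"] assms(2)
  by (simp add: outer_def flip: sum_distrib_left of_int_sum)

lemma outer_col_sum:
  assumes "bij_betw e UNIV {..<n}" "(\<Sum>i<n. u ! i) = 0"
  shows "(\<Sum>a\<in>UNIV. outer e u v $ a $ b) = (0 :: real)"
  using sum_over_index[OF assms(1), of "\<lambda>i. real_of_int (u ! i)"] assms(2)
  by (simp add: outer_def flip: sum_distrib_right of_int_sum)

text \<open>The antidiagonal sum pairs \<open>u\<close> with the reversal of \<open>v\<close>, and
  reversal acts on the label \<open>v\<close> by the sign shown.\<close>

lemma antitrace_outer_Ulist:
  assumes "n \<ge> 2" "bij_betw e UNIV {..<n}" "v \<in> set (Ulist n)"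
  shows "antitrace n e (outer e u v) = (if skew v then -1 else 1) * real_of_int (idot n u v)"
proof -
  let ?s = "if skew v then -1 else 1 :: int"
  have "(\<Sum>i<n. u ! i * v ! (n - 1 - i)) = (\<Sum>i<n. ?s * (u ! i * v ! i))"
    using splitting_reflect[OF splitting_Ulist[OF assms(1)] assms(3)] by (intro sum.cong) auto
  then have "(\<Sum>i<n. u ! i * v ! (n - 1 - i)) = ?s * idot n u v"
    by (simp only: idot_def sum_distrib_left)
  then show ?thesis by (simp add: antitrace_outer[OF assms(2)] flip: of_int_sum of_int_mult)
qed

section \<open>Combinations of the diagonal products, weighted by vectors of smaller length\<close>

definition diag :: "('n::finite \<Rightarrow> nat) \<Rightarrow> int list list \<Rightarrow> (nat \<Rightarrow> real) \<Rightarrow> real^'n^'n" where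
  "diag e L c = (\<Sum>j<length L. c j *\<^sub>R outer e (L ! j) (L ! j))"

text \<open>The matrices \<open>xbar\<close> are the case \<open>m = 2\<close>, since skew-symmetric vectors have squared norm 2,
  and \<open>ybar\<close> is the case \<open>m = \<ell>\<close>, since the trace \<open>\<ell>\<^sub>j\<close> is a squared norm.\<close>

definition weighted :: "nat \<Rightarrow> ('n::finite \<Rightarrow> nat) \<Rightarrow> real \<Rightarrow> int list list \<Rightarrow> int list \<Rightarrow> real^'n^'n" where
  "weighted n e m L w = diag e L (\<lambda>j. m / real_of_int (idot n (L ! j) (L ! j)) * real_of_int (w ! j))"

lemma inner_outer_diag:
  fixes e :: "'n::finite \<Rightarrow> nat"
  assumes "bij_betw e UNIV {..<n}" "\<And>j. j < length L \<Longrightarrow> idot n u (L ! j) * idot n v (L ! j) = 0"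
  shows "outer e u v \<bullet> diag e L c = 0"
proof -
  have "outer e u v \<bullet> diag e L c =
      (\<Sum>j<length L. c j * real_of_int (idot n u (L ! j) * idot n v (L ! j)))"
    by (simp add: diag_def inner_sum_right inner_outer[OF assms(1)])
  also have "\<dots> = 0"
    by (intro sum.neutral) (simp add: assms(2) del: of_int_mult)
  finally show ?thesis .
qed

text \<open>Outer squares of distinct labels are orthogonal, and that of \<open>u\<close> has
  squared norm \<open>(idot n u u)^2\<close>, so only the diagonal of the double sum
  survives.\<close>

lemma inner_diag:
  fixes e :: "'n::finite \<Rightarrow> nat"
  assumes "n \<ge> 2" "bij_betw e UNIV {..<n}" "distinct L" "set L \<subseteq> set (Ulist n)"
  shows "diag e L c \<bullet> diag e L d = (\<Sum>j<length L. c j * d j * (idot n (L ! j) (L ! j))\<^sup>2)"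
proof -
  have "outer e (L ! i) (L ! i) \<bullet> diag e L d = d i * (idot n (L ! i) (L ! i))\<^sup>2"
    if i: "i < length L" for i
  proof -
    have "outer e (L ! i) (L ! i) \<bullet> diag e L d =
        (\<Sum>j<length L. d j * (real_of_int (idot n (L ! i) (L ! j)))\<^sup>2)"
      by (simp add: diag_def inner_sum_right inner_outer[OF assms(2)] power2_eq_square)
    also have "\<dots> = (\<Sum>j\<in>{i}. d j * (real_of_int (idot n (L ! i) (L ! j)))\<^sup>2)"
    proof (intro sum.mono_neutral_right ballI)
      fix j assume j: "j \<in> {..<length L} - {i}"
      then have "idot n (L ! i) (L ! j) = 0"
        using assms(3,4) i by (intro Ulist_orthogonal[OF assms(1)]) (auto simp: nth_eq_iff_index_eq)
      then show "d j * (real_of_int (idot n (L ! i) (L ! j)))\<^sup>2 = 0" by simp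
    qed (use i in auto)
    finally show ?thesis by simp
  qed
  then show ?thesis
    by (subst diag_def) (simp add: inner_sum_left mult.assoc)
qed

text \<open>The weights \<open>m / idot n (L ! j) (L ! j)\<close> cancel the norms of the outer
  squares. Thus \<open>w\<close> is mapped to matrices by a similarity, through which orthogonality
  in \<open>U(length L)\<close> is inherited.\<close>

lemma inner_weighted:
  fixes e :: "'n::finite \<Rightarrow> nat"
  assumes "n \<ge> 2" "bij_betw e UNIV {..<n}" "distinct L" "set L \<subseteq> set (Ulist n)"
  shows "weighted n e m L w \<bullet> weighted n e m L w' = m\<^sup>2 * real_of_int (idot (length L) w w')"
proof -
  have "real_of_int (idot n (L ! j) (L ! j)) \<noteq> 0" if "j < length L" for j
    using Ulist_pos[OF assms(1), of "L ! j"] assms(4) that by (auto simp: subset_eq)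
  then show ?thesis
    unfolding weighted_def inner_diag[OF assms] idot_def[of "length L"]
    by (simp add: sum_distrib_left power2_eq_square algebra_simps)
qed

text \<open>The numbers \<open>c j * idot n (L ! j) (L ! j)\<close> have zero sum, so they expand in
  \<open>U(length L)\<close>. Dividing by the squared norms turns this expansion into one of the
  matrix in the weighted family.\<close>

lemma diag_in_span_weighted:
  fixes e :: "'n::finite \<Rightarrow> nat"
  assumes "n \<ge> 2" "set L \<subseteq> set (Ulist n)" "m \<noteq> 0"
    and "(\<Sum>j<length L. c j * real_of_int (idot n (L ! j) (L ! j))) = 0"
  shows "diag e L c \<in> span ((\<lambda>i. weighted n e m L (uvec (length L) i)) ` {1..length L - 1})"
    (is "_ \<in> span (?F ` _)")
proof -
  let ?K = "length L"
  define t where "t j = real_of_int (idot n (L ! j) (L ! j))" for j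
  have t: "t j \<noteq> 0" if "j < ?K" for j
    using Ulist_pos[OF assms(1), of "L ! j"] assms(2) that by (auto simp: t_def subset_eq)
  \<comment> \<open>Below length 2 the family is empty, so the matrix itself has to be zero; for
    length 1 the zero sum forces the only coefficient to vanish.\<close>
  consider "?K = 0" | "?K = 1" | "?K \<ge> 2" by linarith
  then show ?thesis
  proof cases
    case 1
    then show ?thesis by (simp add: diag_def span_zero)
  next
    case 2
    then have "c 0 = 0" using assms(4) t[of 0] by (simp add: t_def)
    with 2 show ?thesis by (simp add: diag_def span_zero)
  next
    case 3
    let ?W = "set (Ulist ?K)"
    define h where "h w = (\<Sum>l<?K. c l * t l * real_of_int (w ! l)) / real_of_int (idot ?K w w)" for w
    have "c j * t j = (\<Sum>w\<in>?W. h w * real_of_int (w ! j))" if "j < ?K" for j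
      using Ulist_expansion[OF 3, of "\<lambda>j. c j * t j"] assms(4) that by (simp add: h_def t_def)
    then have "c j = (\<Sum>w\<in>?W. h w / m * (m / t j * real_of_int (w ! j)))" if "j < ?K" for j
      using t[of j] assms(3) that by (simp add: field_simps flip: sum_divide_distrib)
    then have "diag e L c =
        (\<Sum>j<?K. (\<Sum>w\<in>?W. h w / m * (m / t j * real_of_int (w ! j))) *\<^sub>R outer e (L ! j) (L ! j))"
      unfolding diag_def by (intro sum.cong) auto
    also have "\<dots> = (\<Sum>w\<in>?W. (h w / m) *\<^sub>R weighted n e m L w)"
      unfolding weighted_def diag_def scaleR_sum_right scaleR_sum_left t_def[symmetric]
      by (subst sum.swap) simp
    also have "\<dots> \<in> span ((\<lambda>w. weighted n e m L w) ` ?W)"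
      by (intro span_sum span_scale span_base imageI)
    also have "(\<lambda>w. weighted n e m L w) ` ?W = ?F ` {1..?K - 1}"
      unfolding uvec_image[OF 3, symmetric] image_image ..
    finally show ?thesis .
  qed
qed

lemma weighted_orthogonality:
  fixes e :: "'n::finite \<Rightarrow> nat"
  assumes "n \<ge> 2" "bij_betw e UNIV {..<n}" "distinct L" "set L \<subseteq> set (Ulist n)" "m \<noteq> 0"
  shows "pairwise orthogonal ((\<lambda>i. weighted n e m L (uvec (length L) i)) ` {1..length L - 1})"
    and "0 \<notin> (\<lambda>i. weighted n e m L (uvec (length L) i)) ` {1..length L - 1}"
proof -
  let ?K = "length L"
  show "pairwise orthogonal ((\<lambda>i. weighted n e m L (uvec ?K i)) ` {1..?K - 1})"
    unfolding pairwise_def orthogonal_def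
  proof (intro ballI impI, elim imageE, goal_cases)
    case (1 x y i j)
    then have "uvec ?K i \<noteq> uvec ?K j" by auto
    then have "idot ?K (uvec ?K i) (uvec ?K j) = 0"
      using 1 by (intro Ulist_orthogonal uvec_mem)
    with 1 show ?case by (simp add: inner_weighted[OF assms(1-4)])
  qed
  show "0 \<notin> (\<lambda>i. weighted n e m L (uvec ?K i)) ` {1..?K - 1}"
  proof (rule notI, elim imageE)
    fix i assume i: "0 = weighted n e m L (uvec ?K i)" "i \<in> {1..?K - 1}"
    have "m\<^sup>2 * real_of_int (idot ?K (uvec ?K i) (uvec ?K i)) = 0"
      by (simp add: inner_weighted[OF assms(1-4), symmetric] i(1)[symmetric])
    with assms(5) Ulist_pos[OF uvec_mem(2,1)[OF i(2)]] show False by simp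
  qed
qed

text \<open>The trace is \<open>m\<close> times the entry sum of a vector from
  \<open>U(length L)\<close>, hence zero. Since all of \<open>L\<close> has the same skewness
  \<open>b\<close>, the antidiagonal sum is this trace up to one common sign.\<close>

lemma weighted_in_Vbar:
  fixes e :: "'n::finite \<Rightarrow> nat"
  assumes "n \<ge> 2" "bij_betw e UNIV {..<n}" "set L \<subseteq> set (Ulist n)"
    and "\<And>u. u \<in> set L \<Longrightarrow> skew u = b" "i \<in> {1..length L - 1}"
  shows "weighted n e m L (uvec (length L) i) \<in> Vbar n e"
proof -
  let ?K = "length L" and ?w = "uvec (length L) i" and ?s = "if b then -1 else 1 :: real"
  define c where "c j = m / real_of_int (idot n (L ! j) (L ! j)) * real_of_int (?w ! j)" for j
  have W: "weighted n e m L ?w = (\<Sum>j<?K. c j *\<^sub>R outer e (L ! j) (L ! j))"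
    by (simp add: weighted_def diag_def c_def)
  have L: "L ! j \<in> set (Ulist n)" if "j < ?K" for j using assms(3) that by (auto simp: subset_eq)
  have c: "c j * real_of_int (idot n (L ! j) (L ! j)) = m * real_of_int (?w ! j)" if "j < ?K" for j
    using Ulist_pos[OF assms(1) L[OF that]] by (simp add: c_def)
  have "(\<Sum>j<?K. ?w ! j) = 0" using uvec_mem[OF assms(5)] by (intro Ulist_sum)
  then have s0: "(\<Sum>j<?K. c j * real_of_int (idot n (L ! j) (L ! j))) = 0"
    using c by (simp flip: sum_distrib_left of_int_sum)
  have "trace (weighted n e m L ?w) = 0"
    using s0 by (simp add: W linear_sum[OF linear_trace] linear_cmul[OF linear_trace]
        trace_outer[OF assms(2)])
  moreover have "antitrace n e (weighted n e m L ?w) =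
      (\<Sum>j<?K. ?s * (c j * real_of_int (idot n (L ! j) (L ! j))))"
    unfolding W linear_sum[OF linear_antitrace] linear_cmul[OF linear_antitrace]
    using antitrace_outer_Ulist[OF assms(1,2) L] assms(4) by (intro sum.cong) auto
  then have "antitrace n e (weighted n e m L ?w) = 0"
    using s0 by (simp flip: sum_distrib_left)
  moreover have "(\<Sum>b\<in>UNIV. weighted n e m L ?w $ a $ b) = 0" for a
  proof -
    have "(\<Sum>b\<in>UNIV. weighted n e m L ?w $ a $ b) =
        (\<Sum>j<?K. c j * (\<Sum>b\<in>UNIV. outer e (L ! j) (L ! j) $ a $ b))"
      unfolding W by (simp add: sum_distrib_left) (rule sum.swap)
    also have "\<dots> = 0"
      using outer_row_sum[OF assms(2) Ulist_sum[OF assms(1) L]] by simp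
    finally show ?thesis .
  qed
  moreover have "(\<Sum>a\<in>UNIV. weighted n e m L ?w $ a $ b) = 0" for b
  proof -
    have "(\<Sum>a\<in>UNIV. weighted n e m L ?w $ a $ b) =
        (\<Sum>j<?K. c j * (\<Sum>a\<in>UNIV. outer e (L ! j) (L ! j) $ a $ b))"
      unfolding W by (simp add: sum_distrib_left) (rule sum.swap)
    also have "\<dots> = 0"
      using outer_col_sum[OF assms(2) Ulist_sum[OF assms(1) L]] by simp
    finally show ?thesis .
  qed
  ultimately show ?thesis by (simp add: Vbar_altdef)
qed

section \<open>Membership of the off-diagonal products and expansion of matrices in
  \<open>Vbar\<close>\<close>

lemma outer_in_Vbar:
  assumes "n \<ge> 2" "bij_betw e UNIV {..<n}" "u \<in> set (Ulist n)" "v \<in> set (Ulist n)" "u \<noteq> v"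
  shows "outer e u v \<in> Vbar n e"
  unfolding Vbar_altdef
  using outer_row_sum[OF assms(2) Ulist_sum[OF assms(1,4)]]
    outer_col_sum[OF assms(2) Ulist_sum[OF assms(1,3)]]
    trace_outer[OF assms(2), where 'a = real, of u v] antitrace_outer_Ulist[OF assms(1,2,4), of u]
    Ulist_orthogonal[OF assms(1,3-5)]
  by auto

lemma Ulist_expansion_finite:
  fixes f :: "'n::finite \<Rightarrow> real"
  assumes "n \<ge> 2" "bij_betw e UNIV {..<n}" "(\<Sum>a\<in>UNIV. f a) = 0"
  shows "f a = (\<Sum>u\<in>set (Ulist n).
    (\<Sum>b\<in>UNIV. f b * real_of_int (u ! e b)) / real_of_int (idot n u u) * real_of_int (u ! e a))"
proof -
  have inv: "inv e (e b) = b" for b using assms(2) by (simp add: bij_betw_def inv_f_f)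
  have "e a < n" using assms(2) by (auto simp: bij_betw_def)
  moreover have "(\<Sum>i<n. f (inv e i)) = 0"
    using sum_over_index[OF assms(2), of "\<lambda>i. f (inv e i)"] assms(3) by (simp add: inv)
  moreover have "(\<Sum>i<n. f (inv e i) * real_of_int (u ! i)) = (\<Sum>b\<in>UNIV. f b * real_of_int (u ! e b))" for u
    using sum_over_index[OF assms(2), of "\<lambda>i. f (inv e i) * real_of_int (u ! i)"] by (simp add: inv)
  ultimately show ?thesis
    using Ulist_expansion[OF assms(1), of "\<lambda>i. f (inv e i)" "e a"] by (simp add: inv)
qed

text \<open>Each row has zero sum and expands in the labels. The coefficient \<open>d v p\<close>,
  as a function of the row \<open>p\<close>, again has zero sum because the columns do, so it can be
  expanded as well.\<close>

lemma Vbar_expansion: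
  fixes e :: "'n::finite \<Rightarrow> nat"
  assumes "n \<ge> 2" "bij_betw e UNIV {..<n}" "X \<in> Vbar n e"
  shows "\<exists>c. X = (\<Sum>u\<in>set (Ulist n). \<Sum>v\<in>set (Ulist n). c u v *\<^sub>R outer e u v)"
proof -
  let ?U = "set (Ulist n)"
  define d where "d v p = (\<Sum>q\<in>UNIV. X $ p $ q * real_of_int (v ! e q)) / real_of_int (idot n v v)" for v p
  define c where
    "c u v = (\<Sum>p\<in>UNIV. d v p * real_of_int (u ! e p)) / real_of_int (idot n u u)" for u v
  have row: "(\<Sum>q\<in>UNIV. X $ p $ q) = 0" and col: "(\<Sum>p\<in>UNIV. X $ p $ q) = 0" for p q
    using assms(3) by (auto simp: Vbar_def)
  have X: "X $ p $ q = (\<Sum>v\<in>?U. d v p * real_of_int (v ! e q))" for p q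
    unfolding d_def using row[of p] by (rule Ulist_expansion_finite[OF assms(1,2)])
  have d: "d v p = (\<Sum>u\<in>?U. c u v * real_of_int (u ! e p))" for v p
    unfolding c_def
  proof (rule Ulist_expansion_finite[OF assms(1,2)])
    have "(\<Sum>p\<in>UNIV. \<Sum>q\<in>UNIV. X $ p $ q * real_of_int (v ! e q)) = 0"
      by (subst sum.swap) (simp add: col flip: sum_distrib_right)
    then show "(\<Sum>p\<in>UNIV. d v p) = 0" by (simp add: d_def flip: sum_divide_distrib)
  qed
  have "X = (\<Sum>u\<in>?U. \<Sum>v\<in>?U. c u v *\<^sub>R outer e u v)"
  proof (intro vec_eq_iff[THEN iffD2] allI)
    fix p q
    have "X $ p $ q = (\<Sum>v\<in>?U. \<Sum>u\<in>?U. c u v * real_of_int (u ! e p) * real_of_int (v ! e q))"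
      by (simp add: X d sum_distrib_right)
    also have "\<dots> = (\<Sum>u\<in>?U. \<Sum>v\<in>?U. c u v *\<^sub>R outer e u v) $ p $ q"
      by (subst sum.swap) (simp add: outer_def mult.assoc)
    finally show "X $ p $ q = (\<Sum>u\<in>?U. \<Sum>v\<in>?U. c u v *\<^sub>R outer e u v) $ p $ q" .
  qed
  then show ?thesis by blast
qed

section \<open>The families \<open>xbar\<close> and \<open>ybar\<close> as weighted
  combinations\<close>

lemma sum_set_filter:
  "sum f (set xs) = sum f (set (filter P xs)) + sum f (set (filter (\<lambda>x. \<not> P x) xs))"
  by (subst sum.union_disjoint[symmetric]) (auto intro!: sum.cong)

lemma sum_set_conv_nth:
  assumes "distinct L"
  shows "sum f (set L) = (\<Sum>j<length L. f (L ! j))"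
  using sum.reindex_bij_betw[OF bij_betw_nth[OF assms refl refl], of f] by simp

lemma xbar_weighted:
  fixes e :: "'n::finite \<Rightarrow> nat"
  assumes "n \<ge> 2"
  shows "xbar n e i = weighted n e 2 (filter skew (Ulist n)) (uvec (n div 2) i)"
proof -
  let ?L = "filter skew (Ulist n)"
  have "idot n (?L ! j) (?L ! j) = 2" if "j < n div 2" for j
  proof -
    have "?L ! j \<in> set ?L" using that Ulist_length_skew[OF assms] by (intro nth_mem) simp
    then show ?thesis using splitting_skew_norm[OF splitting_Ulist[OF assms]] by auto
  qed
  then show ?thesis
    by (simp add: xbar_def xmat_def weighted_def diag_def Ulist_length_skew[OF assms] Let_def
        sum.atLeast1_atMost_eq)
qed

lemma ell_eq_idot:
  fixes e :: "'n::finite \<Rightarrow> nat"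
  assumes "bij_betw e UNIV {..<n}"
  shows "ell n e (Suc j) =
    (let u = filter (\<lambda>u. \<not> skew u) (Ulist n) ! j in idot n u u)"
  by (simp add: ell_def ymat_def Let_def trace_outer[OF assms])

lemma ybar_weighted:
  fixes e :: "'n::finite \<Rightarrow> nat"
  assumes "n \<ge> 2" "bij_betw e UNIV {..<n}"
  shows "ybar n e i = weighted n e (real_of_int (ell_lcm n e))
    (filter (\<lambda>u. \<not> skew u) (Ulist n)) (uvec ((n - 1) div 2) i)"
  by (simp add: ybar_def ymat_def weighted_def diag_def Ulist_length_symmetric[OF assms(1)] Let_def
      sum.atLeast1_atMost_eq ell_eq_idot[OF assms(2)])

text \<open>Every \<open>ell\<close> in question is the squared norm of a nonzero label, and the lcm
  of a finite set vanishes only if the set contains 0. With \<open>k' = 0\<close> the lcm is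
  1.\<close>

lemma ell_lcm_nonzero:
  fixes e :: "'n::finite \<Rightarrow> nat"
  assumes "n \<ge> 2" "bij_betw e UNIV {..<n}"
  shows "ell_lcm n e \<noteq> 0"
proof -
  let ?L = "filter (\<lambda>u. \<not> skew u) (Ulist n)"
  have "ell n e i \<noteq> 0" if i: "i \<in> {1..(n - 1) div 2}" for i
  proof -
    obtain j where j: "i = Suc j" "j < (n - 1) div 2" using i by (cases i) auto
    then have "?L ! j \<in> set ?L" using Ulist_length_symmetric[OF assms(1)] by (intro nth_mem) simp
    then have "idot n (?L ! j) (?L ! j) > 0" using Ulist_pos[OF assms(1)] by simp
    then show ?thesis by (simp add: j(1) ell_eq_idot[OF assms(2)] Let_def)
  qed
  then have "0 \<notin> ell n e ` {1..(n - 1) div 2}" by auto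
  then show ?thesis by (simp add: ell_lcm_def Lcm_0_iff)
qed

section \<open>Assembling the basis: orthogonality, independence and span\<close>

theorem theorem4p2:
  fixes n :: nat and e :: "'n::finite \<Rightarrow> nat"
  assumes "n \<ge> 2"
    and "bij_betw e UNIV {..<n}"
  shows "orthogonal_basis (basis_set n e) (Vbar n e)"
proof -
  let ?U = "set (Ulist n)"
  let ?S = "filter skew (Ulist n)" and ?A = "filter (\<lambda>u. \<not> skew u) (Ulist n)"
  define M where "M = {outer e u v :: real^'n^'n | u v. u \<in> ?U \<and> v \<in> ?U \<and> u \<noteq> v}"
  define F where "F m L = (\<lambda>i. weighted n e m L (uvec (length L) i)) ` {1..length L - 1}" for m L
  define l where "l = real_of_int (ell_lcm n e)"
  have l: "l \<noteq> 0" using ell_lcm_nonzero[OF assms] by (simp add: l_def)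
  have dS: "distinct ?S" and dA: "distinct ?A" using Ulist_distinct[OF assms(1)] by auto
  have sS: "set ?S \<subseteq> ?U" and sA: "set ?A \<subseteq> ?U" by auto
  have orth: "idot n u v = 0" if "u \<in> ?U" "v \<in> ?U" "u \<noteq> v" for u v
    using Ulist_orthogonal[OF assms(1) that] .
  have xF: "xbar n e ` {1..n div 2 - 1} = F 2 ?S"
    by (simp add: F_def Ulist_length_skew[OF assms(1)] xbar_weighted[OF assms(1)] cong: image_cong)
  have yF: "ybar n e ` {1..(n - 1) div 2 - 1} = F l ?A"
    by (simp add: F_def Ulist_length_symmetric[OF assms(1)] ybar_weighted[OF assms] l_def
        cong: image_cong)
  \<comment> \<open>\<open>Ulist n\<close> has no repetitions, so distinct indices amount to
    distinct labels and the products can be indexed by the labels themselves.\<close>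
  have M_eq: "{outer e (uvec n i) (uvec n j) | i j. i \<in> {1..n - 1} \<and> j \<in> {1..n - 1} \<and> i \<noteq> j} = M"
  proof -
    have len: "length (Ulist n) = n - 1"
      using splitting_length[OF splitting_Ulist[OF assms(1)]] by simp
    have inj: "inj_on (uvec n) {1..n - 1}"
    proof (rule inj_onI)
      fix i j assume ij: "i \<in> {1..n - 1}" "j \<in> {1..n - 1}" "uvec n i = uvec n j"
      then have "i - 1 = j - 1"
        using nth_eq_iff_index_eq[OF Ulist_distinct[OF assms(1)], of "i - 1" "j - 1"] len
        by (auto simp: uvec_def)
      with ij show "i = j" by auto
    qed
    show ?thesis (is "?R = M")
    proof (intro equalityI subsetI)
      fix x assume "x \<in> ?R"
      then obtain i j where ij: "x = outer e (uvec n i) (uvec n j)"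
          "i \<in> {1..n - 1}" "j \<in> {1..n - 1}" "i \<noteq> j"
        by blast
      then have "uvec n i \<noteq> uvec n j" using inj by (metis inj_onD)
      moreover have "uvec n i \<in> ?U" "uvec n j \<in> ?U" using ij by (simp_all add: uvec_mem)
      ultimately show "x \<in> M" unfolding M_def ij(1) by blast
    next
      fix x assume "x \<in> M"
      then obtain u v where uv: "x = outer e u v" "u \<in> ?U" "v \<in> ?U" "u \<noteq> v"
        unfolding M_def by blast
      obtain i where "u = uvec n i" "i \<in> {1..n - 1}"
        using uv(2) unfolding uvec_image[OF assms(1), symmetric] by blast
      moreover obtain j where "v = uvec n j" "j \<in> {1..n - 1}"
        using uv(3) unfolding uvec_image[OF assms(1), symmetric] by blast
      ultimately show "x \<in> ?R" using uv(1,4) by blast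
    qed
  qed
  have B: "basis_set n e = M \<union> F 2 ?S \<union> F l ?A"
    unfolding basis_set_def xF yF M_eq ..

  have MF: "x \<bullet> y = 0" if "x \<in> M" "y \<in> F m L" "set L \<subseteq> ?U" for x y m L
  proof -
    obtain u v where uv: "x = outer e u v" "u \<in> ?U" "v \<in> ?U" "u \<noteq> v" using \<open>x \<in> M\<close> M_def by blast
    \<comment> \<open>Since \<open>u\<close> and \<open>v\<close> differ, at most one of them equals
      \<open>L ! j\<close>; the other is orthogonal to it.\<close>
    have "idot n u (L ! j) * idot n v (L ! j) = 0" if j: "j < length L" for j
    proof -
      have "L ! j \<in> ?U" using \<open>set L \<subseteq> ?U\<close> j by (simp add: subset_eq)
      with orth[of u "L ! j"] orth[of v "L ! j"] uv show ?thesis by auto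
    qed
    with uv(1) \<open>y \<in> F m L\<close> show ?thesis
      by (auto simp: F_def weighted_def intro: inner_outer_diag[OF assms(2)])
  qed
  have FF: "x \<bullet> y = 0" if xy: "x \<in> F 2 ?S" "y \<in> F l ?A" for x y
  proof -
    have "outer e (?S ! j) (?S ! j) \<bullet> y = 0" if j: "j < length ?S" for j
    proof -
      have Sj: "?S ! j \<in> set ?S" using j by (rule nth_mem)
      \<comment> \<open>A skew and a non-skew label are distinct, hence orthogonal.\<close>
      have "idot n (?S ! j) (?A ! k) * idot n (?S ! j) (?A ! k) = 0" if k: "k < length ?A" for k
      proof -
        have Ak: "?A ! k \<in> set ?A" using k by (rule nth_mem)
        have "skew (?S ! j)" "\<not> skew (?A ! k)" using Sj Ak by simp_all
        then have "?S ! j \<noteq> ?A ! k" by metis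
        with Sj Ak show ?thesis by (simp add: orth)
      qed
      with xy(2) show ?thesis
        by (auto simp: F_def weighted_def intro: inner_outer_diag[OF assms(2)])
    qed
    with xy(1) show ?thesis by (auto simp: F_def weighted_def diag_def inner_sum_left)
  qed
  have MM: "x \<bullet> y = 0" if xy: "x \<in> M" "y \<in> M" "x \<noteq> y" for x y
  proof -
    obtain u v u' v' where *: "x = outer e u v" "y = outer e u' v'" "u \<in> ?U" "v \<in> ?U" "u' \<in> ?U" "v' \<in> ?U"
      using xy(1,2) unfolding M_def by blast
    with xy(3) have "u \<noteq> u' \<or> v \<noteq> v'" by auto
    with * orth[of u u'] orth[of v v'] show ?thesis by (auto simp: inner_outer[OF assms(2)])
  qed
  note wS = weighted_orthogonality[OF assms dS sS, of 2] and wA = weighted_orthogonality[OF assms dA sA l]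
  have pw: "pairwise orthogonal (basis_set n e)"
    unfolding B pairwise_def orthogonal_def
  proof (intro ballI impI)
    fix x y assume "x \<in> M \<union> F 2 ?S \<union> F l ?A" "y \<in> M \<union> F 2 ?S \<union> F l ?A" and ne: "x \<noteq> y"
    moreover have "x \<bullet> y = 0" if "x \<in> F 2 ?S" "y \<in> F 2 ?S"
      using pairwiseD[OF wS(1)] that ne unfolding F_def orthogonal_def by simp
    moreover have "x \<bullet> y = 0" if "x \<in> F l ?A" "y \<in> F l ?A"
      using pairwiseD[OF wA(1)] that ne unfolding F_def orthogonal_def by simp
    moreover have "x \<bullet> y = 0" if "y \<in> M" "x \<in> F m L" "set L \<subseteq> ?U" for m L
      using MF[OF that] by (simp add: inner_commute)
    moreover have "x \<bullet> y = 0" if "x \<in> F l ?A" "y \<in> F 2 ?S"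
      using FF[OF that(2,1)] by (simp add: inner_commute)
    ultimately show "x \<bullet> y = 0" using MM MF FF sS sA by (elim UnE) metis+
  qed
  \<comment> \<open>Pairwise orthogonality gives independence once the zero matrix is
    excluded.\<close>
  moreover have "0 \<notin> basis_set n e"
  proof -
    have "0 \<notin> M"
    proof
      assume "0 \<in> M"
      then obtain u v where uv: "u \<in> ?U" "v \<in> ?U" "(0 :: real^'n^'n) = outer e u v"
        unfolding M_def by blast
      have "real_of_int (idot n u u * idot n v v) = 0"
        by (simp only: inner_outer[OF assms(2), symmetric] uv(3)[symmetric] inner_zero_left)
      with Ulist_pos[OF assms(1) uv(1)] Ulist_pos[OF assms(1) uv(2)] show False by simp
    qed
    with wS(2) wA(2) show ?thesis unfolding B F_def by simp
  qed
  ultimately have ind: "independent (basis_set n e)" by (rule pairwise_orthogonal_independent)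

  have "basis_set n e \<subseteq> Vbar n e"
    unfolding B F_def M_def
    using outer_in_Vbar[OF assms] weighted_in_Vbar[OF assms sS, of True]
      weighted_in_Vbar[OF assms sA, of False] by auto
  then have "span (basis_set n e) \<subseteq> Vbar n e"
    by (rule span_minimal[OF _ subspace_Vbar])
  moreover have "X \<in> span (basis_set n e)" if X: "X \<in> Vbar n e" for X
  proof -
    obtain c where c: "X = (\<Sum>u\<in>?U. \<Sum>v\<in>?U. c u v *\<^sub>R outer e u v)"
      using Vbar_expansion[OF assms X] by blast
    \<comment> \<open>The contribution of \<open>u\<close> to the trace; \<open>D\<close> and
      \<open>R\<close> are the diagonal and off-diagonal parts of the expansion.\<close>
    define t where "t u = c u u * real_of_int (idot n u u)" for u
    define D :: "real^'n^'n" where "D = (\<Sum>u\<in>?U. c u u *\<^sub>R outer e u u)"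
    define R :: "real^'n^'n" where "R = (\<Sum>u\<in>?U. \<Sum>v\<in>?U - {u}. c u v *\<^sub>R outer e u v)"
    have split: "X = R + D"
      unfolding c R_def D_def sum.distrib[symmetric]
    proof (rule sum.cong[OF refl])
      fix u assume "u \<in> ?U"
      from sum.remove[OF finite_set this, of "\<lambda>v. c u v *\<^sub>R outer e u v"]
      show "(\<Sum>v\<in>?U. c u v *\<^sub>R outer e u v) =
          (\<Sum>v\<in>?U - {u}. c u v *\<^sub>R outer e u v) + (c u u *\<^sub>R outer e u u :: real^'n^'n)"
        by (simp only: add.commute)
    qed
    have off: "R \<in> span M"
      unfolding R_def
      by (intro span_sum span_scale span_base) (auto simp: M_def)
    \<comment> \<open>As \<open>R\<close> lies in \<open>Vbar\<close>, so does
      \<open>D = X - R\<close>, and the trace and antidiagonal conditions become conditions on the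
      diagonal coefficients alone.\<close>
    have "R \<in> Vbar n e"
      unfolding R_def
      by (intro subspace_sum subspace_scale subspace_Vbar outer_in_Vbar[OF assms]) auto
    from subspace_diff[OF subspace_Vbar X this] have "D \<in> Vbar n e" by (simp add: split)
    then have "trace D = 0" "antitrace n e D = 0" by (auto simp: Vbar_altdef)
    moreover have "trace D = (\<Sum>u\<in>?U. t u)"
      by (simp add: D_def t_def linear_sum[OF linear_trace] linear_cmul[OF linear_trace] trace_outer[OF assms(2)])
    moreover have "antitrace n e D = (\<Sum>u\<in>?U. (if skew u then -1 else 1) * t u)"
      unfolding D_def t_def linear_sum[OF linear_antitrace] linear_cmul[OF linear_antitrace]
      by (intro sum.cong) (auto simp: antitrace_outer_Ulist[OF assms])
    ultimately have "sum t ?U = 0" "(\<Sum>u\<in>?U. (if skew u then -1 else 1) * t u) = 0" by simp_all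
    \<comment> \<open>The two conditions are the sum and the difference of the skew and symmetric
      contributions, so each contribution vanishes and each part of \<open>D\<close> lies in the
      span of its own weighted family.\<close>
    then have "sum t (set ?S) + sum t (set ?A) = 0" "- sum t (set ?S) + sum t (set ?A) = 0"
      unfolding sum_set_filter[of _ "Ulist n" skew] by (simp_all add: sum_negf)
    then have t0: "sum t (set ?S) = 0" "sum t (set ?A) = 0" by linarith+
    have "(\<Sum>u\<in>set L. c u u *\<^sub>R outer e u u) \<in> span (F m L)"
      if "distinct L" "set L \<subseteq> ?U" "m \<noteq> 0" "sum t (set L) = 0" for L m
    proof -
      have "diag e L (\<lambda>j. c (L ! j) (L ! j)) \<in> span (F m L)"
        unfolding F_def using that(1,4)
        by (intro diag_in_span_weighted assms that) (simp add: t_def sum_set_conv_nth)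
      then show ?thesis by (simp add: diag_def sum_set_conv_nth[OF that(1)])
    qed
    from this[OF dS sS _ t0(1), of 2] this[OF dA sA l t0(2)]
    have "D \<in> span (basis_set n e)"
      unfolding D_def sum_set_filter[of _ "Ulist n" skew] B by (intro span_add) (auto elim: rev_subsetD intro!: span_mono)
    moreover have "span M \<subseteq> span (basis_set n e)" unfolding B by (intro span_mono) auto
    ultimately show ?thesis unfolding split using off by (intro span_add) auto
  qed
  ultimately show ?thesis unfolding orthogonal_basis_def using pw ind by blast
qed

end
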